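(* Let $A_1,A_2\in\mathbf{C}^{n\times n}$, $F_1,F_2\in\mathbf{C}^{p\times p}$ and $C_1,C_2\in\mathbf{C}^{n\times p}$. Assume that $$\rho\{A_1,A_2\}\,\rho\{F_1,F_2\}<1,$$ and let $\{D_1(k),D_2(k)\}=\sum_{i=0}^{k-1}\{A_1,A_2\}^i\{C_1,C_2\}\{F_1,F_2\}^i$ for $k\ge1$. Then the Stein bimatrix equation $$\{X_1,X_2\}=\{A_1,A_2\}\{X_1,X_2\}\{F_1,F_2\}+\{C_1,C_2\}$$ has a unique solution, given by $$\{X_1,X_2\}=\sum_{k=0}^{\infty}\{A_1,A_2\}^k\{C_1,C_2\}\{F_1,F_2\}^k.$$ Particularly, if the discrete-time complex-valued linear system $x(t+1)=\{A_1,A_2\}x(t)$ is asymptotically stable, then, for $\{Q_1,Q_2\}>0$ of size $n\times n$, the solution to the discrete-time Lyapunov bimatrix equation $$\{P_1,P_2\}=\{A_1,A_2\}^{\mathrm H}\{P_1,P_2\}\{A_1,A_2\}+\{Q_1,Q_2\}$$ is given by $$\{P_1,P_2\}=\sum_{k=0}^{\infty}\left(\{A_1,A_2\}^{\mathrm H}\right)^k\{Q_1,Q_2\}\{A_1,A_2\}^k.$$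
   Context: $A^{\#}$, $A^{\mathrm T}$, $A^{\mathrm H}$ denote the conjugate, transpose and conjugate transpose of $A$. A bimatrix $\{A_1,A_2\}\in\{\mathbf{C}^{n\times m},\mathbf{C}^{n\times m}\}$ is a pair of matrices of the same size, identified with the real-linear map $x\mapsto A_1x+A_2^{\#}x^{\#}$. Addition (and convergence of series) is componentwise, and the product corresponds to composition: $\{A_1,A_2\}\{X_1,X_2\}=\{A_1X_1+A_2^{\#}X_2,\;A_1^{\#}X_2+A_2X_1\}$; the zeroth power of a square bimatrix is the identity $\{I_n,0_{n\times n}\}$. The complex lifting is $\{P_1,P_2\}_\diamond=\begin{bmatrix}P_1&P_2^{\#}\\P_2&P_1^{\#}\end{bmatrix}$ and is multiplicative; eigenvalues of a square bimatrix are those of its lifting, and $\rho\{P_1,P_2\}$ is the spectral radius, i.e. the maximal modulus of the eigenvalues. The conjugate transpose $\{A_1,A_2\}^{\mathrm H}=\{A_1^{\mathrm H},A_2^{\mathrm T}\}$ is the bimatrix whose lifting is $(\{A_1,A_2\}_\diamond)^{\mathrm H}$. $\{Q_1,Q_2\}>0$ means that $\{Q_1,Q_2\}_\diamond$ is Hermitian positive definite. The system $x(t+1)=\{A_1,A_2\}x(t)$ is asymptotically stable if and only if $\rho\{A_1,A_2\}<1$. *)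

theory Defs
  imports
    "Jordan_Normal_Form.Spectral_Radius"
    "Jordan_Normal_Form.Schur_Decomposition"
    "HOL-Analysis.L2_Norm"
begin

type_synonym bimat = "complex mat \<times> complex mat"

definition carrier_bimat :: "nat \<Rightarrow> nat \<Rightarrow> bimat set" where
  "carrier_bimat n m = carrier_mat n m \<times> carrier_mat n m"

abbreviation mat_conj :: "complex mat \<Rightarrow> complex mat" where
  "mat_conj A \<equiv> map_mat cnj A"

definition bim_apply :: "bimat \<Rightarrow> complex vec \<Rightarrow> complex vec" where
  "bim_apply A x = fst A *\<^sub>v x + mat_conj (snd A) *\<^sub>v conjugate x"

definition bim_zero :: "nat \<Rightarrow> nat \<Rightarrow> bimat" where
  "bim_zero n m = (0\<^sub>m n m, 0\<^sub>m n m)"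

definition bim_one :: "nat \<Rightarrow> bimat" where
  "bim_one n = (1\<^sub>m n, 0\<^sub>m n n)"

definition bim_add :: "bimat \<Rightarrow> bimat \<Rightarrow> bimat" (infixl \<open>+\<^sub>b\<close> 65) where
  "A +\<^sub>b B = (fst A + fst B, snd A + snd B)"

definition bim_mult :: "bimat \<Rightarrow> bimat \<Rightarrow> bimat" (infixl \<open>*\<^sub>b\<close> 70) where
  "A *\<^sub>b X = (fst A * fst X + mat_conj (snd A) * snd X,
             mat_conj (fst A) * snd X + snd A * fst X)"

primrec bim_pow :: "bimat \<Rightarrow> nat \<Rightarrow> bimat" (infixr \<open>^\<^sub>b\<close> 75) where
  "A ^\<^sub>b 0 = bim_one (dim_row (fst A))"
| "A ^\<^sub>b (Suc k) = A ^\<^sub>b k *\<^sub>b A"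

definition bim_adjoint :: "bimat \<Rightarrow> bimat" where
  "bim_adjoint A = (mat_adjoint (fst A), transpose_mat (snd A))"

definition bim_lift :: "bimat \<Rightarrow> complex mat" where
  "bim_lift P = four_block_mat (fst P) (mat_conj (snd P)) (snd P) (mat_conj (fst P))"

lemma mat_adjoint_eq_transpose_conj: "mat_adjoint A = transpose_mat (mat_conj A)"
  unfolding mat_adjoint_def by (rule eq_matI) (auto simp: mat_of_rows_index)

lemma bim_lift_adjoint:
  assumes "A \<in> carrier_bimat n m"
  shows "bim_lift (bim_adjoint A) = mat_adjoint (bim_lift A)"
  using assms unfolding bim_lift_def bim_adjoint_def carrier_bimat_def
  by (intro eq_matI) (auto simp: mat_adjoint_eq_transpose_conj)

lemma bim_lift_mult:
  assumes "A \<in> carrier_bimat n m" and "B \<in> carrier_bimat m l"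
  shows "bim_lift (A *\<^sub>b B) = bim_lift A * bim_lift B"
  using assms unfolding bim_lift_def bim_mult_def carrier_bimat_def
  apply clarsimp
  apply (subst mult_four_block_mat[of _ n m _ m _ n _ _ l _ l])
  apply (auto simp: map_mat_def)
  apply (rule arg_cong4[where f = four_block_mat])
  apply (auto intro!: eq_matI simp: scalar_prod_def)
  done

definition bim_spectral_radius :: "bimat \<Rightarrow> real" where
  "bim_spectral_radius P = spectral_radius (bim_lift P)"

definition hermitian_pos_def :: "complex mat \<Rightarrow> bool" where
  "hermitian_pos_def M \<longleftrightarrow>
     square_mat M \<and> mat_adjoint M = M \<and>
     (\<forall>v \<in> carrier_vec (dim_row M). v \<noteq> 0\<^sub>v (dim_row M) \<longrightarrow> 0 < Re ((M *\<^sub>v v) \<bullet>c v))"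

definition bim_pos_def :: "bimat \<Rightarrow> bool" where
  "bim_pos_def Q \<longleftrightarrow> hermitian_pos_def (bim_lift Q)"

text \<open>Matrices of all sizes share one type, so convergence also requires that the members of the
  sequence eventually have the size of the limit.\<close>

definition mat_tendsto :: "(nat \<Rightarrow> complex mat) \<Rightarrow> complex mat \<Rightarrow> bool" where
  "mat_tendsto M L \<longleftrightarrow>
     (\<forall>\<^sub>F k in sequentially. M k \<in> carrier_mat (dim_row L) (dim_col L)) \<and>
     (\<forall>i < dim_row L. \<forall>j < dim_col L. (\<lambda>k. M k $$ (i, j)) \<longlonglongrightarrow> L $$ (i, j))"

definition bim_tendsto :: "(nat \<Rightarrow> bimat) \<Rightarrow> bimat \<Rightarrow> bool" where
  "bim_tendsto M L \<longleftrightarrow>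
     mat_tendsto (\<lambda>k. fst (M k)) (fst L) \<and> mat_tendsto (\<lambda>k. snd (M k)) (snd L)"

text \<open>The sum of \<open>f i\<close> over \<open>i < k\<close>; the size \<open>n\<close>, \<open>m\<close> is only needed for the empty sum.\<close>

primrec bim_sum :: "nat \<Rightarrow> nat \<Rightarrow> (nat \<Rightarrow> bimat) \<Rightarrow> nat \<Rightarrow> bimat" where
  "bim_sum n m f 0 = bim_zero n m"
| "bim_sum n m f (Suc k) = bim_sum n m f k +\<^sub>b f k"

definition bim_sums :: "nat \<Rightarrow> nat \<Rightarrow> (nat \<Rightarrow> bimat) \<Rightarrow> bimat \<Rightarrow> bool" where
  "bim_sums n m f X \<longleftrightarrow> bim_tendsto (bim_sum n m f) X"

definition cvec_norm :: "complex vec \<Rightarrow> real" where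
  "cvec_norm x = L2_set (\<lambda>i. cmod (x $ i)) {..<dim_vec x}"

definition bim_trajectory :: "nat \<Rightarrow> bimat \<Rightarrow> (nat \<Rightarrow> complex vec) \<Rightarrow> bool" where
  "bim_trajectory n A x \<longleftrightarrow>
     x 0 \<in> carrier_vec n \<and> (\<forall>t. x (Suc t) = bim_apply A (x t))"

text \<open>Asymptotic stability: the zero solution is stable in the sense of Lyapunov, and
  every solution tends to zero.\<close>

definition bim_asymptotically_stable :: "nat \<Rightarrow> bimat \<Rightarrow> bool" where
  "bim_asymptotically_stable n A \<longleftrightarrow>
     (\<forall>\<epsilon>>0. \<exists>\<delta>>0. \<forall>x. bim_trajectory n A x \<and> cvec_norm (x 0) < \<delta> \<longrightarrow>
        (\<forall>t. cvec_norm (x t) < \<epsilon>)) \<and>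
     (\<forall>x. bim_trajectory n A x \<longrightarrow> (\<lambda>t. cvec_norm (x t)) \<longlonglongrightarrow> 0)"

end

theory Submission
  imports Defs
begin

text \<open>Through the lifting, bimatrices inherit the algebra of complex matrices. Scaling each lifted
  factor so that its spectral radius drops below 1 bounds the terms \<open>A\<^sup>k C F\<^sup>k\<close> entrywise by a geometric
  sequence with ratio \<open>r < 1\<close>. Hence the series converges, its limit solves the equation by continuity,
  and unrolling \<open>X = A X F + C\<close> to \<open>X = A\<^sup>k X F\<^sup>k + D k\<close> shows that every solution is that limit. The
  Lyapunov equation is the special case \<open>(A\<^sup>H, A, Q)\<close>.\<close>

text \<open>Only the product of the two spectral radii is below 1, so one factor may be expanding
  and its powers cannot be bounded on their own. Moreover Jordan blocks let the powers of a matrix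
  outgrow its spectral radius by a polynomial factor. Both obstacles are met by picking
  \<open>a\<close> and \<open>b\<close> strictly above the two radii with \<open>a * b < 1\<close>:
  the slack absorbs the polynomial factors, and \<open>a * b\<close> is the ratio \<open>r\<close>.
  For the Lyapunov equation, stability speaks of trajectories and has to be turned into a statement
  about eigenvalues of the lifting. The system is merely real-linear: a state \<open>x\<close>
  appears in the lifting as the pair of \<open>x\<close> and its conjugate, while an eigenvector
  need not have this shape. Two trajectories together recover it. The adjoint then has the conjugate
  eigenvalues, so both factors have radius below 1.\<close>

lemma carrier_bimat_iff:
  "A \<in> carrier_bimat n m \<longleftrightarrow> fst A \<in> carrier_mat n m \<and> snd A \<in> carrier_mat n m"
  by (cases A) (simp add: carrier_bimat_def)

lemma bim_zero_carrier [simp]: "bim_zero n m \<in> carrier_bimat n m"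
  by (simp add: carrier_bimat_iff bim_zero_def)

lemma bim_one_carrier [simp]: "bim_one n \<in> carrier_bimat n n"
  by (simp add: carrier_bimat_iff bim_one_def)

lemma bim_add_carrier [simp, intro]:
  "A \<in> carrier_bimat n m \<Longrightarrow> B \<in> carrier_bimat n m \<Longrightarrow> A +\<^sub>b B \<in> carrier_bimat n m"
  by (simp add: carrier_bimat_iff bim_add_def)

lemma bim_mult_carrier [simp, intro]:
  "A \<in> carrier_bimat n m \<Longrightarrow> B \<in> carrier_bimat m l \<Longrightarrow> A *\<^sub>b B \<in> carrier_bimat n l"
  unfolding carrier_bimat_iff bim_mult_def by auto

lemma bim_pow_carrier [simp, intro]:
  "A \<in> carrier_bimat n n \<Longrightarrow> A ^\<^sub>b k \<in> carrier_bimat n n"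
  by (induction k) (auto simp: carrier_bimat_iff[of A] intro: bim_mult_carrier)

lemma bim_adjoint_carrier [simp, intro]:
  "A \<in> carrier_bimat n m \<Longrightarrow> bim_adjoint A \<in> carrier_bimat m n"
  by (simp add: carrier_bimat_iff bim_adjoint_def mat_adjoint_eq_transpose_conj)

lemma bim_sum_carrier [simp, intro]:
  "(\<And>k. f k \<in> carrier_bimat n m) \<Longrightarrow> bim_sum n m f k \<in> carrier_bimat n m"
  by (induction k) auto

section \<open>The lifting as an injective homomorphism, and the identities pulled back along
  it\<close>

lemma bim_lift_carrier [simp, intro]:
  "A \<in> carrier_bimat n m \<Longrightarrow> bim_lift A \<in> carrier_mat (n + n) (m + m)"
  unfolding carrier_bimat_iff bim_lift_def by auto

lemma bim_lift_index:
  assumes "A \<in> carrier_bimat n m" "i < n" "j < m"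
  shows "bim_lift A $$ (i, j) = fst A $$ (i, j)" "bim_lift A $$ (n + i, j) = snd A $$ (i, j)"
  using assms by (auto simp: carrier_bimat_iff bim_lift_def)

text \<open>The first block column of the lifting holds both components. Injectivity reduces each
  algebraic law below to the same law for complex matrices.\<close>

lemma bim_lift_inject:
  assumes A: "A \<in> carrier_bimat n m" and B: "B \<in> carrier_bimat n m"
    and eq: "bim_lift A = bim_lift B"
  shows "A = B"
proof (rule prod_eqI)
  show "fst A = fst B"
    using A B bim_lift_index(1)[OF A] bim_lift_index(1)[OF B] eq
    by (intro eq_matI) (auto simp: carrier_bimat_iff)
  show "snd A = snd B"
    using A B bim_lift_index(2)[OF A] bim_lift_index(2)[OF B] eq
    by (intro eq_matI) (auto simp: carrier_bimat_iff)
qed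

lemma bim_lift_add:
  assumes "A \<in> carrier_bimat n m" "B \<in> carrier_bimat n m"
  shows "bim_lift (A +\<^sub>b B) = bim_lift A + bim_lift B"
  using assms unfolding bim_lift_def bim_add_def carrier_bimat_iff
  by (intro eq_matI) auto

lemma bim_lift_one: "bim_lift (bim_one n) = 1\<^sub>m (n + n)"
  unfolding bim_lift_def bim_one_def by (intro eq_matI) auto

lemma bim_lift_pow:
  assumes "A \<in> carrier_bimat n n"
  shows "bim_lift (A ^\<^sub>b k) = bim_lift A ^\<^sub>m k"
proof (induction k)
  case 0
  \<comment> \<open>Each zeroth power reads the size of its identity from its base, so the two sizes
    must be seen to match.\<close>
  have "dim_row (fst A) = n" "dim_row (bim_lift A) = n + n"
    using assms by (auto simp: carrier_bimat_iff bim_lift_def)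
  then show ?case by (simp add: bim_lift_one)
next
  case (Suc k)
  with assms show ?case by (simp add: bim_lift_mult[of _ n n _ n])
qed

text \<open>Lifting both sides leaves associativity of matrix products. The instances are spelled
  out because the inner dimension of a product is not visible in the product itself.\<close>

lemma bim_mult_assoc:
  assumes "A \<in> carrier_bimat n m" "B \<in> carrier_bimat m l" "C \<in> carrier_bimat l q"
  shows "A *\<^sub>b B *\<^sub>b C = A *\<^sub>b (B *\<^sub>b C)"
proof (rule bim_lift_inject[of _ n q])
  show "bim_lift (A *\<^sub>b B *\<^sub>b C) = bim_lift (A *\<^sub>b (B *\<^sub>b C))"
    using assms bim_lift_carrier[OF assms(1)] bim_lift_carrier[OF assms(2)]
      bim_lift_carrier[OF assms(3)]
    by (simp add: bim_lift_mult[of _ n m _ l] bim_lift_mult[of _ n l _ q]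
        bim_lift_mult[of _ m l _ q] bim_lift_mult[of _ n m _ q] bim_mult_carrier[of _ n m]
        bim_mult_carrier[of _ m l] assoc_mult_mat[of _ "n + n" "m + m" _ "l + l" _ "q + q"])
qed (use assms in auto)

lemma bim_mult_add_right:
  assumes "A \<in> carrier_bimat n m" "B \<in> carrier_bimat m l" "C \<in> carrier_bimat m l"
  shows "A *\<^sub>b (B +\<^sub>b C) = A *\<^sub>b B +\<^sub>b A *\<^sub>b C"
proof (rule bim_lift_inject[of _ n l])
  show "bim_lift (A *\<^sub>b (B +\<^sub>b C)) = bim_lift (A *\<^sub>b B +\<^sub>b A *\<^sub>b C)"
    using assms bim_lift_carrier[OF assms(1)] bim_lift_carrier[OF assms(2)]
      bim_lift_carrier[OF assms(3)]
    by (simp add: bim_lift_mult[of _ n m _ l] bim_lift_add[of _ n l] bim_lift_add[of _ m l]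
        bim_add_carrier[of _ m l] bim_mult_carrier[of _ n m _ l]
        mult_add_distrib_mat[of _ "n + n" "m + m" _ "l + l"])
qed (use assms in auto)

lemma bim_mult_add_left:
  assumes "A \<in> carrier_bimat n m" "B \<in> carrier_bimat n m" "C \<in> carrier_bimat m l"
  shows "(A +\<^sub>b B) *\<^sub>b C = A *\<^sub>b C +\<^sub>b B *\<^sub>b C"
proof (rule bim_lift_inject[of _ n l])
  show "bim_lift ((A +\<^sub>b B) *\<^sub>b C) = bim_lift (A *\<^sub>b C +\<^sub>b B *\<^sub>b C)"
    using assms bim_lift_carrier[OF assms(1)] bim_lift_carrier[OF assms(2)]
      bim_lift_carrier[OF assms(3)]
    by (simp add: bim_lift_mult[of _ n m _ l] bim_lift_add[of _ n l] bim_lift_add[of _ n m]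
        bim_add_carrier[of _ n m] bim_mult_carrier[of _ n m _ l]
        add_mult_distrib_mat[of _ "n + n" "m + m" _ _ "l + l"])
qed (use assms in auto)

lemma bim_one_mult:
  assumes "A \<in> carrier_bimat n m"
  shows "bim_one n *\<^sub>b A = A"
proof (rule bim_lift_inject[of _ n m])
  show "bim_lift (bim_one n *\<^sub>b A) = bim_lift A"
    using assms left_mult_one_mat[OF bim_lift_carrier[OF assms]]
    by (simp add: bim_lift_mult[of _ n n _ m] bim_lift_one)
qed (use assms bim_mult_carrier[OF bim_one_carrier assms] in auto)

lemma bim_mult_one:
  assumes "A \<in> carrier_bimat n m"
  shows "A *\<^sub>b bim_one m = A"
proof (rule bim_lift_inject[of _ n m])
  show "bim_lift (A *\<^sub>b bim_one m) = bim_lift A"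
    using assms right_mult_one_mat[OF bim_lift_carrier[OF assms]]
    by (simp add: bim_lift_mult[of _ n m _ m] bim_lift_one)
qed (use assms in auto)

text \<open>Powers grow on the right by definition, but \<open>A\<close> has to be peeled off on the
  outer side of \<open>A ^\<^sub>b k *\<^sub>b C *\<^sub>b F ^\<^sub>b k\<close>, and
  \<open>F\<close> on the inner side; both are left factors of their power.\<close>

lemma bim_pow_Suc_left:
  assumes "A \<in> carrier_bimat n n"
  shows "A ^\<^sub>b Suc k = A *\<^sub>b A ^\<^sub>b k"
proof (induction k)
  case 0
  have "dim_row (fst A) = n" using assms by (auto simp: carrier_bimat_iff)
  with assms show ?case by (simp add: bim_one_mult bim_mult_one)
next
  case (Suc k)
  have "A ^\<^sub>b Suc (Suc k) = A *\<^sub>b A ^\<^sub>b k *\<^sub>b A" using Suc by simp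
  also have "\<dots> = A *\<^sub>b A ^\<^sub>b Suc k" using assms by (simp add: bim_mult_assoc[of _ n n _ n])
  finally show ?case .
qed

lemma bim_add_assoc:
  assumes "A \<in> carrier_bimat n m" "B \<in> carrier_bimat n m" "C \<in> carrier_bimat n m"
  shows "A +\<^sub>b B +\<^sub>b C = A +\<^sub>b (B +\<^sub>b C)"
  using assms by (auto simp: bim_add_def carrier_bimat_iff)

lemma bim_add_comm:
  assumes "A \<in> carrier_bimat n m" "B \<in> carrier_bimat n m"
  shows "A +\<^sub>b B = B +\<^sub>b A"
  using assms by (auto simp: bim_add_def carrier_bimat_iff intro: comm_add_mat)

lemma bim_add_zero_right:
  assumes "A \<in> carrier_bimat n m"
  shows "A +\<^sub>b bim_zero n m = A"
  using assms by (auto simp: bim_add_def bim_zero_def carrier_bimat_iff)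

subsection \<open>Convergence\<close>

lemma null_sequence_comparison:
  fixes f :: "nat \<Rightarrow> 'a :: real_normed_vector"
  assumes "g \<longlonglongrightarrow> 0" "\<And>k. norm (f k) \<le> g k"
  shows "f \<longlonglongrightarrow> 0"
  using assms(1) by (rule tendsto_0_le[where K = 1])
    (auto intro!: always_eventually order_trans[OF assms(2) abs_ge_self])

text \<open>Entrywise uniqueness makes sense only for limits of equal size. Some single member
  \<open>M k\<close> has the size of both limits, which forces these sizes to agree.\<close>

lemma mat_tendsto_unique:
  assumes "mat_tendsto M L" "mat_tendsto M K"
  shows "L = K"
proof -
  have "\<forall>\<^sub>F k in sequentially. M k \<in> carrier_mat (dim_row L) (dim_col L) \<and>
      M k \<in> carrier_mat (dim_row K) (dim_col K)"
    using assms by (auto simp: mat_tendsto_def eventually_conj_iff)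
  from eventually_happens'[OF sequentially_bot this]
  obtain k where "M k \<in> carrier_mat (dim_row L) (dim_col L)"
      "M k \<in> carrier_mat (dim_row K) (dim_col K)"
    by blast
  then have d: "dim_row L = dim_row K" "dim_col L = dim_col K" by auto
  show ?thesis
  proof (rule eq_matI)
    fix i j assume "i < dim_row K" "j < dim_col K"
    then have "(\<lambda>k. M k $$ (i, j)) \<longlonglongrightarrow> L $$ (i, j)" "(\<lambda>k. M k $$ (i, j)) \<longlonglongrightarrow> K $$ (i, j)"
      using assms d by (simp_all add: mat_tendsto_def)
    then show "L $$ (i, j) = K $$ (i, j)" by (rule LIMSEQ_unique)
  qed (rule d)+
qed

text \<open>The entry formula of the sum is available only once both sequences have reached the size
  of their limits. The limit of the entries is therefore carried over along an eventual equality;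
  products and conjugates follow the same pattern.\<close>

lemma mat_tendsto_add:
  assumes "mat_tendsto M L" "mat_tendsto N K"
    and d: "dim_row L = dim_row K" "dim_col L = dim_col K"
  shows "mat_tendsto (\<lambda>k. M k + N k) (L + K)"
  unfolding mat_tendsto_def
proof (intro conjI allI impI)
  have ev: "\<forall>\<^sub>F k in sequentially. M k \<in> carrier_mat (dim_row K) (dim_col K) \<and>
      N k \<in> carrier_mat (dim_row K) (dim_col K)"
    using assms by (auto simp: mat_tendsto_def eventually_conj_iff)
  then show "\<forall>\<^sub>F k in sequentially. M k + N k \<in> carrier_mat (dim_row (L + K)) (dim_col (L + K))"
    by eventually_elim auto
  fix i j assume ij: "i < dim_row (L + K)" "j < dim_col (L + K)"
  have lim: "(\<lambda>k. M k $$ (i, j) + N k $$ (i, j)) \<longlonglongrightarrow> L $$ (i, j) + K $$ (i, j)"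
    using assms ij by (intro tendsto_add) (auto simp: mat_tendsto_def)
  have tr: "\<forall>\<^sub>F k in sequentially. M k $$ (i, j) + N k $$ (i, j) = (M k + N k) $$ (i, j)"
    using ev by eventually_elim (use ij in auto)
  have eq: "L $$ (i, j) + K $$ (i, j) = (L + K) $$ (i, j)" using ij by simp
  show "(\<lambda>k. (M k + N k) $$ (i, j)) \<longlonglongrightarrow> (L + K) $$ (i, j)"
    by (rule Lim_transform_eventually[OF lim[unfolded eq] tr])
qed

lemma mat_tendsto_mult:
  assumes "mat_tendsto M L" "mat_tendsto N K" and d: "dim_col L = dim_row K"
  shows "mat_tendsto (\<lambda>k. M k * N k) (L * K)"
  unfolding mat_tendsto_def
proof (intro conjI allI impI)
  have ev: "\<forall>\<^sub>F k in sequentially. M k \<in> carrier_mat (dim_row L) (dim_row K) \<and>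
      N k \<in> carrier_mat (dim_row K) (dim_col K)"
    using assms by (auto simp: mat_tendsto_def eventually_conj_iff)
  then show "\<forall>\<^sub>F k in sequentially. M k * N k \<in> carrier_mat (dim_row (L * K)) (dim_col (L * K))"
    by eventually_elim auto
  fix i j assume ij: "i < dim_row (L * K)" "j < dim_col (L * K)"
  have lim: "(\<lambda>k. \<Sum>l<dim_row K. M k $$ (i, l) * N k $$ (l, j))
      \<longlonglongrightarrow> (\<Sum>l<dim_row K. L $$ (i, l) * K $$ (l, j))"
    using assms ij by (intro tendsto_sum tendsto_mult) (auto simp: mat_tendsto_def)
  have tr: "\<forall>\<^sub>F k in sequentially.
      (\<Sum>l<dim_row K. M k $$ (i, l) * N k $$ (l, j)) = (M k * N k) $$ (i, j)"
    using ev by eventually_elim (use ij in \<open>auto simp: scalar_prod_def atLeast0LessThan\<close>)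
  have eq: "(\<Sum>l<dim_row K. L $$ (i, l) * K $$ (l, j)) = (L * K) $$ (i, j)"
    using ij d by (auto simp: scalar_prod_def atLeast0LessThan)
  show "(\<lambda>k. (M k * N k) $$ (i, j)) \<longlonglongrightarrow> (L * K) $$ (i, j)"
    by (rule Lim_transform_eventually[OF lim[unfolded eq] tr])
qed

lemma mat_tendsto_conj:
  assumes "mat_tendsto M L"
  shows "mat_tendsto (\<lambda>k. mat_conj (M k)) (mat_conj L)"
  unfolding mat_tendsto_def
proof (intro conjI allI impI)
  have ev: "\<forall>\<^sub>F k in sequentially. M k \<in> carrier_mat (dim_row L) (dim_col L)"
    using assms by (auto simp: mat_tendsto_def)
  then show "\<forall>\<^sub>F k in sequentially. mat_conj (M k) \<in>
      carrier_mat (dim_row (mat_conj L)) (dim_col (mat_conj L))"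
    by eventually_elim auto
  fix i j assume ij: "i < dim_row (mat_conj L)" "j < dim_col (mat_conj L)"
  have lim: "(\<lambda>k. cnj (M k $$ (i, j))) \<longlonglongrightarrow> cnj (L $$ (i, j))"
    using assms ij by (intro tendsto_cnj) (auto simp: mat_tendsto_def)
  have tr: "\<forall>\<^sub>F k in sequentially. cnj (M k $$ (i, j)) = mat_conj (M k) $$ (i, j)"
    using ev by eventually_elim (use ij in auto)
  have eq: "cnj (L $$ (i, j)) = mat_conj L $$ (i, j)" using ij by simp
  show "(\<lambda>k. mat_conj (M k) $$ (i, j)) \<longlonglongrightarrow> mat_conj L $$ (i, j)"
    by (rule Lim_transform_eventually[OF lim[unfolded eq] tr])
qed

lemma mat_tendsto_const: "mat_tendsto (\<lambda>k. L) L"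
  by (simp add: mat_tendsto_def)

lemma bim_tendsto_const: "bim_tendsto (\<lambda>k. L) L"
  by (simp add: bim_tendsto_def mat_tendsto_const)

lemma bim_tendsto_unique: "bim_tendsto M L \<Longrightarrow> bim_tendsto M K \<Longrightarrow> L = K"
  unfolding bim_tendsto_def by (rule prod_eqI; elim conjE; rule mat_tendsto_unique)

lemma bim_tendsto_add:
  assumes "bim_tendsto M L" "bim_tendsto N K"
    and "L \<in> carrier_bimat n m" "K \<in> carrier_bimat n m"
  shows "bim_tendsto (\<lambda>k. M k +\<^sub>b N k) (L +\<^sub>b K)"
proof -
  have d: "dim_row (fst L) = dim_row (fst K)" "dim_col (fst L) = dim_col (fst K)"
      "dim_row (snd L) = dim_row (snd K)" "dim_col (snd L) = dim_col (snd K)"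
    using assms(3,4) by (auto simp: carrier_bimat_iff)
  show ?thesis
    using assms(1,2) d unfolding bim_tendsto_def bim_add_def fst_conv snd_conv
    by (intro conjI mat_tendsto_add) simp_all
qed

lemma bim_tendsto_mult:
  assumes "bim_tendsto M L" "bim_tendsto N K"
    and "L \<in> carrier_bimat n m" "K \<in> carrier_bimat m l"
  shows "bim_tendsto (\<lambda>k. M k *\<^sub>b N k) (L *\<^sub>b K)"
proof -
  have c: "dim_row (fst L) = n" "dim_col (fst L) = m" "dim_row (snd L) = n" "dim_col (snd L) = m"
      "dim_row (fst K) = m" "dim_col (fst K) = l" "dim_row (snd K) = m" "dim_col (snd K) = l"
    using assms(3,4) by (auto simp: carrier_bimat_iff)
  note t = assms(1,2)[unfolded bim_tendsto_def]
  note f = conjunct1[OF t(1)] conjunct1[OF t(2)] and s = conjunct2[OF t(1)] conjunct2[OF t(2)]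
  show ?thesis
    unfolding bim_tendsto_def bim_mult_def fst_conv snd_conv
    by (intro conjI mat_tendsto_add mat_tendsto_mult mat_tendsto_conj f s) (simp_all add: c)
qed

lemma mat_tendsto_Suc: "mat_tendsto M L \<Longrightarrow> mat_tendsto (\<lambda>k. M (Suc k)) L"
  unfolding mat_tendsto_def
  by (auto intro: LIMSEQ_Suc
      intro!: eventually_sequentially_Suc[where P = "\<lambda>k. M k \<in> _", THEN iffD2])

lemma bim_tendsto_Suc: "bim_tendsto M L \<Longrightarrow> bim_tendsto (\<lambda>k. M (Suc k)) L"
  unfolding bim_tendsto_def by (blast intro: mat_tendsto_Suc[of "\<lambda>k. fst (M k)"]
      mat_tendsto_Suc[of "\<lambda>k. snd (M k)"])

lemma mat_tendsto_cong:
  assumes "\<forall>\<^sub>F k in sequentially. M k = N k" "mat_tendsto M L"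
  shows "mat_tendsto N L"
  unfolding mat_tendsto_def
proof (intro conjI allI impI)
  have "\<forall>\<^sub>F k in sequentially. M k \<in> carrier_mat (dim_row L) (dim_col L)"
    using assms(2) by (simp add: mat_tendsto_def)
  then show "\<forall>\<^sub>F k in sequentially. N k \<in> carrier_mat (dim_row L) (dim_col L)"
    using assms(1) by eventually_elim simp
  fix i j assume ij: "i < dim_row L" "j < dim_col L"
  have "\<forall>\<^sub>F k in sequentially. M k $$ (i, j) = N k $$ (i, j)"
    using assms(1) by eventually_elim simp
  moreover have "(\<lambda>k. M k $$ (i, j)) \<longlonglongrightarrow> L $$ (i, j)"
    using assms(2) ij by (simp add: mat_tendsto_def)
  ultimately show "(\<lambda>k. N k $$ (i, j)) \<longlonglongrightarrow> L $$ (i, j)"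
    by (rule Lim_transform_eventually[rotated])
qed

text \<open>This serves the sequence \<open>D\<close>, which is prescribed only from index 1
  on.\<close>

lemma bim_tendsto_cong:
  assumes "\<forall>\<^sub>F k in sequentially. M k = N k" "bim_tendsto M L"
  shows "bim_tendsto N L"
proof -
  have "\<forall>\<^sub>F k in sequentially. fst (M k) = fst (N k)"
       "\<forall>\<^sub>F k in sequentially. snd (M k) = snd (N k)"
    using assms(1) by (eventually_elim, simp)+
  then show ?thesis
    using assms(2) unfolding bim_tendsto_def by (auto intro: mat_tendsto_cong)
qed

section \<open>Series and null sequences of bimatrices under geometric entrywise bounds\<close>

lemma bim_sum_index:
  assumes f: "\<And>k. f k \<in> carrier_bimat n m" and ij: "i < n" "j < m"
  shows "fst (bim_sum n m f k) $$ (i, j) = (\<Sum>l<k. fst (f l) $$ (i, j))"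
    and "snd (bim_sum n m f k) $$ (i, j) = (\<Sum>l<k. snd (f l) $$ (i, j))"
proof (induction k)
  case (Suc k)
  have "bim_sum n m f k \<in> carrier_bimat n m" using f by auto
  note c = this f[of k]
  { case 1 show ?case using Suc c ij by (auto simp: bim_add_def carrier_bimat_iff) }
  { case 2 show ?case using Suc c ij by (auto simp: bim_add_def carrier_bimat_iff) }
qed (use ij in \<open>auto simp: bim_zero_def\<close>)

definition bim_norm_bound :: "bimat \<Rightarrow> real \<Rightarrow> bool" where
  "bim_norm_bound A b \<longleftrightarrow> norm_bound (fst A) b \<and> norm_bound (snd A) b"

lemma bim_norm_bound_lift:
  assumes A: "A \<in> carrier_bimat n m" and b: "norm_bound (bim_lift A) b"
  shows "bim_norm_bound A b"
  unfolding bim_norm_bound_def norm_bound_def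
proof (intro conjI allI impI)
  have d: "dim_row (fst A) = n" "dim_col (fst A) = m" "dim_row (snd A) = n" "dim_col (snd A) = m"
      "dim_row (bim_lift A) = n + n" "dim_col (bim_lift A) = m + m"
    using A bim_lift_carrier[OF A] by (auto simp: carrier_bimat_iff simp del: bim_lift_carrier)
  fix i j
  show "cmod (fst A $$ (i, j)) \<le> b" if "i < dim_row (fst A)" "j < dim_col (fst A)"
    using b that bim_lift_index(1)[OF A, of i j, symmetric] d by (simp add: norm_bound_def)
  show "cmod (snd A $$ (i, j)) \<le> b" if "i < dim_row (snd A)" "j < dim_col (snd A)"
    using b that bim_lift_index(2)[OF A, of i j, symmetric] d by (simp add: norm_bound_def)
qed

text \<open>Each of the finitely many entries is an absolutely convergent complex series by
  comparison with a geometric one, so the sum can be assembled entry by entry.\<close>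

lemma bim_sums_exists:
  assumes f: "\<And>k. f k \<in> carrier_bimat n m"
    and b: "\<And>k. bim_norm_bound (f k) (K * r ^ k)" and r: "0 \<le> r" "r < 1"
  shows "\<exists>X \<in> carrier_bimat n m. bim_sums n m f X"
proof -
  have gs: "summable (\<lambda>k. K * r ^ k)" using r by (intro summable_mult summable_geometric) auto
  have s1: "summable (\<lambda>k. fst (f k) $$ (i, j))" and s2: "summable (\<lambda>k. snd (f k) $$ (i, j))"
    if "i < n" "j < m" for i j
  proof -
    have "cmod (fst (f k) $$ (i, j)) \<le> K * r ^ k" "cmod (snd (f k) $$ (i, j)) \<le> K * r ^ k" for k
      using b[of k] f[of k] that by (auto simp: bim_norm_bound_def norm_bound_def carrier_bimat_iff)
    then show "summable (\<lambda>k. fst (f k) $$ (i, j))" "summable (\<lambda>k. snd (f k) $$ (i, j))"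
      by (auto intro!: summable_comparison_test'[OF gs])
  qed
  define X where "X = (mat n m (\<lambda>ij. \<Sum>k. fst (f k) $$ ij), mat n m (\<lambda>ij. \<Sum>k. snd (f k) $$ ij))"
  have X: "X \<in> carrier_bimat n m" by (simp add: X_def carrier_bimat_iff)
  have S: "bim_sum n m f k \<in> carrier_bimat n m" for k using f by auto
  have "bim_sums n m f X"
    unfolding bim_sums_def bim_tendsto_def mat_tendsto_def
    using S s1 s2
    by (auto simp: X_def carrier_bimat_iff bim_sum_index[OF f] summable_LIMSEQ)
  with X show ?thesis by blast
qed

lemma bim_tendsto_zero:
  assumes f: "\<And>k. f k \<in> carrier_bimat n m"
    and b: "\<And>k. bim_norm_bound (f k) (K * r ^ k)" and r: "0 \<le> r" "r < 1"
  shows "bim_tendsto f (bim_zero n m)"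
proof -
  have "(\<lambda>k. r ^ k) \<longlonglongrightarrow> 0" using r by (intro LIMSEQ_power_zero) auto
  then have g0: "(\<lambda>k. K * r ^ k) \<longlonglongrightarrow> 0" by (rule tendsto_mult_right_zero)
  have "(\<lambda>k. fst (f k) $$ (i, j)) \<longlonglongrightarrow> 0" "(\<lambda>k. snd (f k) $$ (i, j)) \<longlonglongrightarrow> 0"
    if "i < n" "j < m" for i j
  proof -
    have "cmod (fst (f k) $$ (i, j)) \<le> K * r ^ k" "cmod (snd (f k) $$ (i, j)) \<le> K * r ^ k" for k
      using b[of k] f[of k] that by (auto simp: bim_norm_bound_def norm_bound_def carrier_bimat_iff)
    then show "(\<lambda>k. fst (f k) $$ (i, j)) \<longlonglongrightarrow> 0" "(\<lambda>k. snd (f k) $$ (i, j)) \<longlonglongrightarrow> 0"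
      by (auto intro: null_sequence_comparison[OF g0])
  qed
  then show ?thesis
    using f by (auto simp: bim_tendsto_def mat_tendsto_def bim_zero_def carrier_bimat_iff)
qed

subsection \<open>Growth of powers\<close>

lemma smult_mat_pow:
  assumes "(A :: 'a :: comm_ring_1 mat) \<in> carrier_mat n n"
  shows "(c \<cdot>\<^sub>m A) ^\<^sub>m k = c ^ k \<cdot>\<^sub>m A ^\<^sub>m k"
proof (induction k)
  case 0
  from assms show ?case by (intro eq_matI) auto
next
  case (Suc k)
  have "A ^\<^sub>m k \<in> carrier_mat n n" using assms by simp
  with assms Suc have "(c \<cdot>\<^sub>m A) ^\<^sub>m Suc k = c \<cdot>\<^sub>m (c ^ k \<cdot>\<^sub>m (A ^\<^sub>m k * A))"
    by (simp add: mult_smult_assoc_mat[of _ n n _ n] mult_smult_distrib[of _ n n _ n])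
  then show ?case by (intro eq_matI) (auto simp: mult_ac)
qed

text \<open>The maximum defining the spectral radius is attained at an eigenvalue, so a strict bound
  on all eigenvalues stays strict. Positive size makes the spectrum nonempty.\<close>

lemma spectral_radius_lessI:
  assumes "A \<in> carrier_mat n n" "n > 0" "\<And>e. eigenvalue A e \<Longrightarrow> cmod e < b"
  shows "spectral_radius A < b"
  using spectral_radius_mem_max(1)[OF assms(1,2)] assms(3) by (auto simp: spectrum_def)

lemma spectral_radius_nonneg:
  assumes "A \<in> carrier_mat n n" "n > 0"
  shows "0 \<le> spectral_radius A"
  using spectral_radius_mem_max(1)[OF assms] by auto

text \<open>Powers of a matrix with spectral radius below 1 are bounded by a constant, by the Jordan
  normal form. Applied to \<open>A\<close> divided by \<open>a\<close>, this gives growth at most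
  like \<open>a ^ k\<close>.\<close>

lemma norm_bound_pow:
  assumes A: "A \<in> carrier_mat n n" and n: "n > 0" and a: "spectral_radius A < a"
  shows "\<exists>c\<ge>0. \<forall>k. norm_bound (A ^\<^sub>m k) (c * a ^ k)"
proof -
  have a0: "a > 0" using spectral_radius_nonneg[OF A n] a by simp
  define b where "b = complex_of_real (1 / a)"
  have b0: "b \<noteq> 0" using a0 by (simp add: b_def)
  have B: "b \<cdot>\<^sub>m A \<in> carrier_mat n n" using A by simp
  have "spectral_radius (b \<cdot>\<^sub>m A) < 1"
  proof (rule spectral_radius_lessI[OF B n])
    fix e assume "eigenvalue (b \<cdot>\<^sub>m A) e"
    then obtain v where v: "v \<in> carrier_vec n" "v \<noteq> 0\<^sub>v n" "(b \<cdot>\<^sub>m A) *\<^sub>v v = e \<cdot>\<^sub>v v"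
      using A by (auto simp: eigenvalue_def eigenvector_def)
    have "(b \<cdot>\<^sub>m A) *\<^sub>v v = b \<cdot>\<^sub>v (A *\<^sub>v v)"
      using v(1) A by (intro eq_vecI) auto
    then have "b \<cdot>\<^sub>v (A *\<^sub>v v) = e \<cdot>\<^sub>v v" using v by simp
    \<comment> \<open>Undoing the scaling turns an eigenvalue \<open>e\<close> of the scaled matrix
      into the eigenvalue \<open>e / b\<close> of \<open>A\<close>, whose modulus is
      \<open>a\<close> times that of \<open>e\<close>.\<close>
    then have "(1 / b) \<cdot>\<^sub>v (b \<cdot>\<^sub>v (A *\<^sub>v v)) = (1 / b) \<cdot>\<^sub>v (e \<cdot>\<^sub>v v)" by simp
    then have "A *\<^sub>v v = (e / b) \<cdot>\<^sub>v v" using b0 by (simp add: smult_smult_assoc)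
    with v A have "eigenvalue A (e / b)" by (auto simp: eigenvalue_def eigenvector_def)
    then have "cmod (e / b) \<le> spectral_radius A"
      by (intro spectral_radius_mem_max(2)[OF A n]) (auto simp: spectrum_def)
    also note a
    finally show "cmod e < 1" using a0 by (simp add: b_def norm_mult norm_divide field_simps)
  qed
  from spectral_radius_jnf_norm_bound_less_1_upper_triangular[OF B this]
  obtain c where c: "\<And>k. norm_bound ((b \<cdot>\<^sub>m A) ^\<^sub>m k) c" by blast
  show ?thesis
  \<comment> \<open>The absolute value supplies a nonnegative constant without an argument about the
    sign of \<open>c\<close>.\<close>
  proof (intro exI[of _ "\<bar>c\<bar>"] conjI allI)
    fix k show "norm_bound (A ^\<^sub>m k) (\<bar>c\<bar> * a ^ k)"
    proof
      fix i j assume ij: "i < dim_row (A ^\<^sub>m k)" "j < dim_col (A ^\<^sub>m k)"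
      have "cmod (((b \<cdot>\<^sub>m A) ^\<^sub>m k) $$ (i, j)) \<le> c"
        using c[of k] ij pow_mat_dim_square[OF A] pow_mat_dim_square[OF B]
        by (simp add: norm_bound_def del: pow_mat_dim)
      then have "cmod (b ^ k * (A ^\<^sub>m k) $$ (i, j)) \<le> c"
        using ij by (simp add: smult_mat_pow[OF A])
      then have "cmod ((A ^\<^sub>m k) $$ (i, j)) / a ^ k \<le> \<bar>c\<bar>"
        using a0 by (simp add: b_def norm_mult norm_power norm_divide power_divide)
      then show "cmod ((A ^\<^sub>m k) $$ (i, j)) \<le> \<bar>c\<bar> * a ^ k"
        using a0 by (simp add: field_simps)
    qed
  qed simp
qed

text \<open>The product \<open>(x + e) * (y + e)\<close> is continuous in \<open>e\<close>, so it
  stays below 1 for some small \<open>e > 0\<close>. Both factors have to be raised strictly, since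
  \<open>norm_bound_pow\<close> needs room above each radius.\<close>

lemma exists_mult_less_one:
  fixes x y :: real
  assumes "0 \<le> x" "0 \<le> y" "x * y < 1"
  shows "\<exists>a>x. \<exists>b>y. a * b < 1"
proof -
  have "((\<lambda>e. (x + e) * (y + e)) \<longlongrightarrow> (x + 0) * (y + 0)) (at_right 0)"
    by (intro tendsto_intros)
  then have "\<forall>\<^sub>F e in at_right 0. (x + e) * (y + e) < 1"
    using assms by (auto dest: order_tendstoD(2))
  moreover have "\<forall>\<^sub>F e in at_right (0 :: real). e > 0" by (rule eventually_at_right_less)
  ultimately have "\<forall>\<^sub>F e in at_right 0. (x + e) * (y + e) < 1 \<and> e > 0" by eventually_elim simp
  then obtain e where "(x + e) * (y + e) < 1" "e > 0"
    using eventually_happens trivial_limit_at_right_real by blast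
  then show ?thesis by (intro exI[of _ "x + e"] conjI exI[of _ "y + e"]) auto
qed

text \<open>The middle factor is arbitrary because the bound is used twice: with \<open>C\<close>
  for the terms of the series, and with a solution for the remainder after unrolling.\<close>

lemma bim_pow_mult_bound:
  assumes n: "n > 0" and p: "p > 0"
    and A: "A \<in> carrier_bimat n n" and F: "F \<in> carrier_bimat p p" and X: "X \<in> carrier_bimat n p"
    and rho: "bim_spectral_radius A * bim_spectral_radius F < 1"
  shows "\<exists>K r. 0 \<le> r \<and> r < 1 \<and> (\<forall>k. bim_norm_bound (A ^\<^sub>b k *\<^sub>b X *\<^sub>b F ^\<^sub>b k) (K * r ^ k))"
proof -
  note la = bim_lift_carrier[OF A] and lf = bim_lift_carrier[OF F] and lx = bim_lift_carrier[OF X]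
  have n2: "n + n > 0" and p2: "p + p > 0" using n p by auto
  note a0 = spectral_radius_nonneg[OF la n2] and f0 = spectral_radius_nonneg[OF lf p2]
  from exists_mult_less_one[OF a0 f0] rho obtain a b where
    a: "spectral_radius (bim_lift A) < a" and b: "spectral_radius (bim_lift F) < b"
    and ab: "a * b < 1"
    by (auto simp: bim_spectral_radius_def)
  from norm_bound_pow[OF la n2 a] norm_bound_pow[OF lf p2 b] obtain c d where
    c: "c \<ge> 0" "\<And>k. norm_bound (bim_lift A ^\<^sub>m k) (c * a ^ k)" and
    d: "d \<ge> 0" "\<And>k. norm_bound (bim_lift F ^\<^sub>m k) (d * b ^ k)"
    by blast
  obtain x where x: "norm_bound (bim_lift X) x" using norm_bound_max by blast
  \<comment> \<open>An entry of a product sums over the inner dimension, so each of the two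
    multiplications contributes that dimension, \<open>n + n\<close> and \<open>p + p\<close>, next
    to the entrywise bounds.\<close>
  define K where "K = c * x * real (n + n) * d * real (p + p)"
  have "bim_norm_bound (A ^\<^sub>b k *\<^sub>b X *\<^sub>b F ^\<^sub>b k) (K * (a * b) ^ k)" for k
  proof (rule bim_norm_bound_lift[of _ n p])
    have pa: "bim_lift A ^\<^sub>m k \<in> carrier_mat (n + n) (n + n)"
      and pf: "bim_lift F ^\<^sub>m k \<in> carrier_mat (p + p) (p + p)"
      using la lf by simp_all
    have "norm_bound (bim_lift A ^\<^sub>m k * bim_lift X * bim_lift F ^\<^sub>m k)
        (c * a ^ k * x * of_nat (n + n) * (d * b ^ k) * of_nat (p + p))"
      by (rule norm_bound_mult[OF _ pf norm_bound_mult[OF pa lx c(2) x] d(2)])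
        (use pa lx in auto)
    moreover have "bim_lift (A ^\<^sub>b k *\<^sub>b X *\<^sub>b F ^\<^sub>b k)
        = bim_lift A ^\<^sub>m k * bim_lift X * bim_lift F ^\<^sub>m k"
      using A F X
      by (simp add: bim_lift_mult[of _ n p _ p] bim_lift_mult[of _ n n _ p]
          bim_lift_pow[of _ n] bim_lift_pow[of _ p] bim_mult_carrier[of _ n n])
    ultimately show "norm_bound (bim_lift (A ^\<^sub>b k *\<^sub>b X *\<^sub>b F ^\<^sub>b k)) (K * (a * b) ^ k)"
      by (simp add: K_def power_mult_distrib mult_ac)
  qed (use A F X in auto)
  moreover have "0 \<le> a * b" using a b a0 f0 by simp
  ultimately show ?thesis using ab by blast
qed

subsection \<open>The Stein equation\<close>

lemma bim_mult_zero:
  assumes "A \<in> carrier_bimat n m" "B \<in> carrier_bimat l q"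
  shows "A *\<^sub>b bim_zero m l *\<^sub>b B = bim_zero n q"
proof -
  have "A *\<^sub>b bim_zero m l = bim_zero n l"
    using assms(1) by (auto simp: bim_mult_def bim_zero_def carrier_bimat_iff)
  moreover have "bim_zero n l *\<^sub>b B = bim_zero n q"
    using assms(2) map_carrier_mat[of cnj "fst B" l q]
    by (auto simp: bim_mult_def bim_zero_def carrier_bimat_iff scalar_prod_def intro!: eq_matI)
  ultimately show ?thesis by simp
qed

text \<open>The extra factors \<open>A\<close> and \<open>F\<close> may be placed outside or inside.
  The outer form yields the recursion of the partial sums, the inner form matches substituting the
  equation into itself.\<close>

lemma stein_term_Suc:
  assumes A: "A \<in> carrier_bimat n n" and F: "F \<in> carrier_bimat p p" and X: "X \<in> carrier_bimat n p"
  shows "A ^\<^sub>b Suc k *\<^sub>b X *\<^sub>b F ^\<^sub>b Suc k = A *\<^sub>b (A ^\<^sub>b k *\<^sub>b X *\<^sub>b F ^\<^sub>b k) *\<^sub>b F"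
    and "A ^\<^sub>b Suc k *\<^sub>b X *\<^sub>b F ^\<^sub>b Suc k = A ^\<^sub>b k *\<^sub>b (A *\<^sub>b X *\<^sub>b F) *\<^sub>b F ^\<^sub>b k"
proof -
  have P: "A ^\<^sub>b k \<in> carrier_bimat n n" and Q: "F ^\<^sub>b k \<in> carrier_bimat p p" using A F by auto
  note AX = bim_mult_carrier[OF A X] and PX = bim_mult_carrier[OF P X]
  show "A ^\<^sub>b Suc k *\<^sub>b X *\<^sub>b F ^\<^sub>b Suc k = A *\<^sub>b (A ^\<^sub>b k *\<^sub>b X *\<^sub>b F ^\<^sub>b k) *\<^sub>b F"
  proof -
    have "A ^\<^sub>b Suc k *\<^sub>b X *\<^sub>b F ^\<^sub>b Suc k = A *\<^sub>b A ^\<^sub>b k *\<^sub>b X *\<^sub>b (F ^\<^sub>b k *\<^sub>b F)"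
      by (simp only: bim_pow_Suc_left[OF A] bim_pow.simps(2)[of F])
    also have "\<dots> = A *\<^sub>b (A ^\<^sub>b k *\<^sub>b X) *\<^sub>b (F ^\<^sub>b k *\<^sub>b F)"
      by (simp only: bim_mult_assoc[OF A P X])
    also have "\<dots> = A *\<^sub>b (A ^\<^sub>b k *\<^sub>b X) *\<^sub>b F ^\<^sub>b k *\<^sub>b F"
      using bim_mult_assoc[OF bim_mult_carrier[OF A PX] Q F] by simp
    also have "\<dots> = A *\<^sub>b (A ^\<^sub>b k *\<^sub>b X *\<^sub>b F ^\<^sub>b k) *\<^sub>b F"
      by (simp only: bim_mult_assoc[OF A PX Q])
    finally show ?thesis .
  qed
  show "A ^\<^sub>b Suc k *\<^sub>b X *\<^sub>b F ^\<^sub>b Suc k = A ^\<^sub>b k *\<^sub>b (A *\<^sub>b X *\<^sub>b F) *\<^sub>b F ^\<^sub>b k"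
  proof -
    have "A ^\<^sub>b Suc k *\<^sub>b X *\<^sub>b F ^\<^sub>b Suc k = A ^\<^sub>b k *\<^sub>b A *\<^sub>b X *\<^sub>b (F *\<^sub>b F ^\<^sub>b k)"
      by (simp only: bim_pow_Suc_left[OF F] bim_pow.simps(2)[of A])
    also have "\<dots> = A ^\<^sub>b k *\<^sub>b (A *\<^sub>b X) *\<^sub>b (F *\<^sub>b F ^\<^sub>b k)"
      by (simp only: bim_mult_assoc[OF P A X])
    also have "\<dots> = A ^\<^sub>b k *\<^sub>b (A *\<^sub>b X) *\<^sub>b F *\<^sub>b F ^\<^sub>b k"
      using bim_mult_assoc[OF bim_mult_carrier[OF P AX] F Q] by simp
    also have "\<dots> = A ^\<^sub>b k *\<^sub>b (A *\<^sub>b X *\<^sub>b F) *\<^sub>b F ^\<^sub>b k"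
      by (simp only: bim_mult_assoc[OF P AX F])
    finally show ?thesis .
  qed
qed

lemma bim_mult_add_mult:
  assumes A: "A \<in> carrier_bimat n n'" and F: "F \<in> carrier_bimat p' p"
    and X: "X \<in> carrier_bimat n' p'" and Y: "Y \<in> carrier_bimat n' p'"
  shows "A *\<^sub>b (X +\<^sub>b Y) *\<^sub>b F = A *\<^sub>b X *\<^sub>b F +\<^sub>b A *\<^sub>b Y *\<^sub>b F"
  using bim_mult_add_right[OF A X Y]
    bim_mult_add_left[OF bim_mult_carrier[OF A X] bim_mult_carrier[OF A Y] F] by simp

text \<open>The term of index 0 is \<open>C\<close>, and each later term is its predecessor between
  \<open>A\<close> and \<open>F\<close>. In the limit this recursion becomes the Stein
  equation.\<close>

lemma stein_partial_sum_Suc: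
  assumes A: "A \<in> carrier_bimat n n" and F: "F \<in> carrier_bimat p p" and C: "C \<in> carrier_bimat n p"
  defines "T \<equiv> \<lambda>k. A ^\<^sub>b k *\<^sub>b C *\<^sub>b F ^\<^sub>b k"
  defines "S \<equiv> bim_sum n p T"
  shows "S (Suc k) = A *\<^sub>b S k *\<^sub>b F +\<^sub>b C"
proof (induction k)
  case 0
  have "dim_row (fst A) = n" "dim_row (fst F) = p" using A F by (auto simp: carrier_bimat_iff)
  then have "T 0 = C" by (simp add: T_def bim_one_mult[OF C] bim_mult_one[OF C])
  then show ?case by (simp add: S_def bim_mult_zero[OF A F])
next
  case (Suc k)
  have T: "T k \<in> carrier_bimat n p" for k using A F C by (auto simp: T_def)
  then have S: "S k \<in> carrier_bimat n p" for k by (auto simp: S_def)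
  have m: "A *\<^sub>b Y *\<^sub>b F \<in> carrier_bimat n p" if "Y \<in> carrier_bimat n p" for Y
    using A F that by auto
  have "S (Suc (Suc k)) = S (Suc k) +\<^sub>b T (Suc k)" by (simp add: S_def)
  also have "\<dots> = (A *\<^sub>b S k *\<^sub>b F +\<^sub>b C) +\<^sub>b A *\<^sub>b T k *\<^sub>b F"
    unfolding Suc T_def stein_term_Suc(1)[OF A F C] ..
  also have "\<dots> = A *\<^sub>b S k *\<^sub>b F +\<^sub>b A *\<^sub>b T k *\<^sub>b F +\<^sub>b C"
    using bim_add_assoc[OF m[OF S] C m[OF T]] bim_add_assoc[OF m[OF S] m[OF T] C]
      bim_add_comm[OF C m[OF T]] by metis
  also have "\<dots> = A *\<^sub>b S (Suc k) *\<^sub>b F +\<^sub>b C"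
    using bim_mult_add_mult[OF A F S T] by (simp add: S_def)
  finally show ?case .
qed

lemma stein_unroll:
  assumes A: "A \<in> carrier_bimat n n" and F: "F \<in> carrier_bimat p p" and C: "C \<in> carrier_bimat n p"
    and X: "X \<in> carrier_bimat n p" and eq: "X = A *\<^sub>b X *\<^sub>b F +\<^sub>b C"
  defines "T \<equiv> \<lambda>k. A ^\<^sub>b k *\<^sub>b C *\<^sub>b F ^\<^sub>b k"
  shows "X = A ^\<^sub>b k *\<^sub>b X *\<^sub>b F ^\<^sub>b k +\<^sub>b bim_sum n p T k"
proof (induction k)
  case 0
  have "dim_row (fst A) = n" "dim_row (fst F) = p" using A F by (auto simp: carrier_bimat_iff)
  then show ?case
    using bim_add_zero_right[OF X] by (simp add: bim_one_mult[OF X] bim_mult_one[OF X])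
next
  case (Suc k)
  have P: "A ^\<^sub>b j \<in> carrier_bimat n n" and Q: "F ^\<^sub>b j \<in> carrier_bimat p p" for j using A F by auto
  have T: "T k \<in> carrier_bimat n p" for k using A F C by (auto simp: T_def)
  then have S: "bim_sum n p T k \<in> carrier_bimat n p" by auto
  have Y: "A ^\<^sub>b Suc k *\<^sub>b X *\<^sub>b F ^\<^sub>b Suc k \<in> carrier_bimat n p"
    by (rule bim_mult_carrier[OF bim_mult_carrier[OF P X] Q])
  have AXF: "A *\<^sub>b X *\<^sub>b F \<in> carrier_bimat n p" using A F X by auto
  \<comment> \<open>One substitution of the equation into the remainder splits off the next term.
    The equation is folded, since \<open>X\<close> occurs on its own right-hand side and unfolding
    would not end.\<close>
  have "A ^\<^sub>b k *\<^sub>b X *\<^sub>b F ^\<^sub>b k = A ^\<^sub>b Suc k *\<^sub>b X *\<^sub>b F ^\<^sub>b Suc k +\<^sub>b T k"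
    using bim_mult_add_mult[OF P Q AXF C, of k k, folded eq]
    unfolding T_def stein_term_Suc(2)[OF A F X] .
  with Suc have "X = A ^\<^sub>b Suc k *\<^sub>b X *\<^sub>b F ^\<^sub>b Suc k +\<^sub>b T k +\<^sub>b bim_sum n p T k" by metis
  also have "\<dots> = A ^\<^sub>b Suc k *\<^sub>b X *\<^sub>b F ^\<^sub>b Suc k +\<^sub>b bim_sum n p T (Suc k)"
    using bim_add_assoc[OF Y T S] bim_add_comm[OF T S] by simp
  finally show ?case .
qed

text \<open>The sum \<open>Y\<close> exists independently of \<open>X\<close>; the unrolled
  identity, valid for every \<open>k\<close>, makes the constant sequence \<open>X\<close> converge
  to \<open>Y\<close>. Uniqueness comes along, as any two solutions are limits of the same partial
  sums.\<close>

lemma stein_solution_sums: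
  assumes n: "n > 0" and p: "p > 0"
    and A: "A \<in> carrier_bimat n n" and F: "F \<in> carrier_bimat p p" and C: "C \<in> carrier_bimat n p"
    and rho: "bim_spectral_radius A * bim_spectral_radius F < 1"
    and X: "X \<in> carrier_bimat n p" and eq: "X = A *\<^sub>b X *\<^sub>b F +\<^sub>b C"
  shows "bim_sums n p (\<lambda>k. A ^\<^sub>b k *\<^sub>b C *\<^sub>b F ^\<^sub>b k) X"
proof -
  define T where "T = (\<lambda>k. A ^\<^sub>b k *\<^sub>b C *\<^sub>b F ^\<^sub>b k)"
  have T: "T k \<in> carrier_bimat n p" for k using A F C by (auto simp: T_def)
  obtain K r where "0 \<le> r" "r < 1" "\<And>k. bim_norm_bound (T k) (K * r ^ k)"
    using bim_pow_mult_bound[OF n p A F C rho] unfolding T_def by blast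
  from bim_sums_exists[OF T this(3,1,2)] obtain Y where
    Y: "Y \<in> carrier_bimat n p" and lim: "bim_tendsto (bim_sum n p T) Y"
    by (auto simp: bim_sums_def)
  obtain K' r' where "0 \<le> r'" "r' < 1"
      "\<And>k. bim_norm_bound (A ^\<^sub>b k *\<^sub>b X *\<^sub>b F ^\<^sub>b k) (K' * r' ^ k)"
    using bim_pow_mult_bound[OF n p A F X rho] by blast
  then have "bim_tendsto (\<lambda>k. A ^\<^sub>b k *\<^sub>b X *\<^sub>b F ^\<^sub>b k) (bim_zero n p)"
    using A F X by (intro bim_tendsto_zero[of _ n p K' r']) auto
  from bim_tendsto_add[OF lim this Y bim_zero_carrier]
  have "bim_tendsto (\<lambda>k. bim_sum n p T k +\<^sub>b A ^\<^sub>b k *\<^sub>b X *\<^sub>b F ^\<^sub>b k) Y"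
    using bim_add_zero_right[OF Y] by simp
  moreover have "bim_sum n p T k +\<^sub>b A ^\<^sub>b k *\<^sub>b X *\<^sub>b F ^\<^sub>b k = X" for k
  proof -
    have "A ^\<^sub>b k *\<^sub>b X *\<^sub>b F ^\<^sub>b k \<in> carrier_bimat n p" using A F X by auto
    then show ?thesis
      using stein_unroll[OF A F C X eq, of k] bim_add_comm[OF bim_sum_carrier[OF T]]
      unfolding T_def by simp
  qed
  ultimately have "bim_tendsto (\<lambda>k. X) Y" by simp
  then have "Y = X" using bim_tendsto_const bim_tendsto_unique by blast
  with lim show ?thesis by (simp add: bim_sums_def T_def)
qed

lemma stein_ex1_solution:
  assumes n: "n > 0" and p: "p > 0"
    and A: "A \<in> carrier_bimat n n" and F: "F \<in> carrier_bimat p p" and C: "C \<in> carrier_bimat n p"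
    and rho: "bim_spectral_radius A * bim_spectral_radius F < 1"
  shows "\<exists>!X. X \<in> carrier_bimat n p \<and> X = A *\<^sub>b X *\<^sub>b F +\<^sub>b C"
proof (rule ex_ex1I)
  define T where "T = (\<lambda>k. A ^\<^sub>b k *\<^sub>b C *\<^sub>b F ^\<^sub>b k)"
  have T: "T k \<in> carrier_bimat n p" for k using A F C by (auto simp: T_def)
  obtain K r where "0 \<le> r" "r < 1" "\<And>k. bim_norm_bound (T k) (K * r ^ k)"
    using bim_pow_mult_bound[OF n p A F C rho] unfolding T_def by blast
  from bim_sums_exists[OF T this(3,1,2)] obtain X where
    X: "X \<in> carrier_bimat n p" and lim: "bim_tendsto (bim_sum n p T) X"
    by (auto simp: bim_sums_def)
  have "bim_tendsto (\<lambda>k. A *\<^sub>b bim_sum n p T k *\<^sub>b F +\<^sub>b C) (A *\<^sub>b X *\<^sub>b F +\<^sub>b C)"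
    using A F C X lim
    by (intro bim_tendsto_add[of _ _ _ _ n p] bim_tendsto_mult[of _ _ _ _ n p p]
        bim_tendsto_mult[of _ _ _ _ n n p] bim_tendsto_const) auto
  \<comment> \<open>By the recursion, the sequence just treated is the shifted sequence of partial
    sums. The shift still tends to \<open>X\<close>, so the two limits coincide.\<close>
  then have "bim_tendsto (\<lambda>k. bim_sum n p T (Suc k)) (A *\<^sub>b X *\<^sub>b F +\<^sub>b C)"
    using stein_partial_sum_Suc[OF A F C] unfolding T_def by (simp del: bim_sum.simps)
  from bim_tendsto_unique[OF bim_tendsto_Suc[OF lim] this]
  show "\<exists>X. X \<in> carrier_bimat n p \<and> X = A *\<^sub>b X *\<^sub>b F +\<^sub>b C" using X by blast
next
  fix X Y
  assume "X \<in> carrier_bimat n p \<and> X = A *\<^sub>b X *\<^sub>b F +\<^sub>b C"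
    and "Y \<in> carrier_bimat n p \<and> Y = A *\<^sub>b Y *\<^sub>b F +\<^sub>b C"
  then show "X = Y"
    using stein_solution_sums[OF n p A F C rho] unfolding bim_sums_def
    by (blast intro: bim_tendsto_unique)
qed

subsection \<open>Asymptotic stability\<close>

text \<open>Transposition preserves the characteristic polynomial and conjugation conjugates its
  coefficients, so its roots are conjugated.\<close>

lemma eigenvalue_mat_adjoint:
  assumes A: "A \<in> carrier_mat n n" and e: "eigenvalue (mat_adjoint A) e"
  shows "eigenvalue A (cnj e)"
proof -
  interpret cnj: comm_ring_hom cnj by unfold_locales auto
  have c: "mat_conj A \<in> carrier_mat n n" "mat_adjoint A \<in> carrier_mat n n"
    using A by (auto simp: mat_adjoint_eq_transpose_conj)
  from e have "poly (char_poly (mat_adjoint A)) e = 0"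
    using eigenvalue_root_char_poly[OF c(2)] by simp
  then have "poly (map_poly cnj (char_poly A)) e = 0"
    by (simp only: mat_adjoint_eq_transpose_conj char_poly_transpose_mat[OF c(1)]
        cnj.char_poly_hom[OF A])
  then show ?thesis using eigenvalue_root_char_poly[OF A] by simp
qed

text \<open>The second block row is the conjugate of the first on vectors of this shape. They thus
  form a real subspace invariant under the lifting, on which it acts as the real-linear map of
  \<open>A\<close>.\<close>

lemma bim_lift_mult_vec:
  assumes A: "A \<in> carrier_bimat n n" and x: "x \<in> carrier_vec n"
  shows "bim_lift A *\<^sub>v (x @\<^sub>v conjugate x) = bim_apply A x @\<^sub>v conjugate (bim_apply A x)"
proof -
  have "bim_lift A *\<^sub>v (x @\<^sub>v conjugate x) =
      (fst A *\<^sub>v x + mat_conj (snd A) *\<^sub>v conjugate x) @\<^sub>v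
      (snd A *\<^sub>v x + mat_conj (fst A) *\<^sub>v conjugate x)"
    unfolding bim_lift_def
    by (rule four_block_mat_mult_vec[of _ n n _ n _ n]) (use A x in \<open>auto simp: carrier_bimat_iff\<close>)
  moreover have "snd A *\<^sub>v x + mat_conj (fst A) *\<^sub>v conjugate x = conjugate (bim_apply A x)"
    using A x by (intro eq_vecI)
      (auto simp: bim_apply_def carrier_bimat_iff scalar_prod_def add.commute)
  ultimately show ?thesis by (simp add: bim_apply_def)
qed

lemma bim_lift_pow_mult_vec:
  assumes A: "A \<in> carrier_bimat n n" and x: "bim_trajectory n A x"
  shows "x k \<in> carrier_vec n \<and>
    bim_lift A ^\<^sub>m k *\<^sub>v (x 0 @\<^sub>v conjugate (x 0)) = x k @\<^sub>v conjugate (x k)"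
proof (induction k)
  case 0
  have "x 0 \<in> carrier_vec n" using x by (simp add: bim_trajectory_def)
  moreover have "dim_row (bim_lift A) = n + n" using bim_lift_carrier[OF A] by auto
  ultimately show ?case by simp
next
  case (Suc k)
  let ?z = "x 0 @\<^sub>v conjugate (x 0)"
  have z: "?z \<in> carrier_vec (n + n)" using x by (auto simp: bim_trajectory_def)
  have xs: "x (Suc k) = bim_apply A (x k)" using x by (simp add: bim_trajectory_def)
  note la = bim_lift_carrier[OF A]
  have la': "bim_lift A ^\<^sub>m k \<in> carrier_mat (n + n) (n + n)" using la by simp
  \<comment> \<open>One more time step applies the lifting last, that is on the left, whereas matrix
    powers grow on the right; the bimatrix law for powers is transported through the
    lifting.\<close>
  have "bim_lift A ^\<^sub>m Suc k = bim_lift A * bim_lift A ^\<^sub>m k"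
    using bim_pow_Suc_left[OF A, of k] bim_lift_mult[OF A bim_pow_carrier[OF A], of k]
      bim_lift_pow[OF A, of k] bim_lift_pow[OF A, of "Suc k"] by metis
  then have "bim_lift A ^\<^sub>m Suc k *\<^sub>v ?z = bim_lift A *\<^sub>v (bim_lift A ^\<^sub>m k *\<^sub>v ?z)"
    using assoc_mult_mat_vec[OF la la' z] by simp
  also have "\<dots> = x (Suc k) @\<^sub>v conjugate (x (Suc k))"
    using Suc bim_lift_mult_vec[OF A] xs by simp
  finally show ?case using A Suc xs by (auto simp: bim_apply_def carrier_bimat_iff)
qed

lemma exists_bim_trajectory:
  assumes "v \<in> carrier_vec n"
  shows "\<exists>x. bim_trajectory n A x \<and> x 0 = v"
  by (rule exI[of _ "rec_nat v (\<lambda>_. bim_apply A)"]) (use assms in \<open>simp add: bim_trajectory_def\<close>)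

lemma stable_pow_tendsto_zero:
  assumes A: "A \<in> carrier_bimat n n" and st: "bim_asymptotically_stable n A"
    and v: "v \<in> carrier_vec n" and j: "j < n + n"
  shows "(\<lambda>k. (bim_lift A ^\<^sub>m k *\<^sub>v (v @\<^sub>v conjugate v)) $ j) \<longlonglongrightarrow> 0"
proof -
  obtain x where x: "bim_trajectory n A x" "x 0 = v" using exists_bim_trajectory[OF v] by blast
  have lim: "(\<lambda>t. cvec_norm (x t)) \<longlonglongrightarrow> 0"
    using st x by (simp add: bim_asymptotically_stable_def)
  have "cmod ((bim_lift A ^\<^sub>m k *\<^sub>v (v @\<^sub>v conjugate v)) $ j) \<le> cvec_norm (x k)" for k
  proof -
    have xk: "x k \<in> carrier_vec n"
      and eq: "bim_lift A ^\<^sub>m k *\<^sub>v (v @\<^sub>v conjugate v) = x k @\<^sub>v conjugate (x k)"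
      using bim_lift_pow_mult_vec[OF A x(1)] x(2) by auto
    have "cmod (x k $ i) \<le> cvec_norm (x k)" if "i < n" for i
      unfolding cvec_norm_def using xk that by (intro member_le_L2_set) auto
    \<comment> \<open>An index from \<open>n\<close> on falls into the conjugated half, where the
      entry has the modulus of entry \<open>j - n\<close> of the state.\<close>
    from this[of j] this[of "j - n"] show ?thesis using xk j by (auto simp: eq)
  qed
  then show ?thesis by (intro null_sequence_comparison[OF lim])
qed

text \<open>Every vector of \<open>\<complex>\<^bsup>2n\<^esup>\<close> is \<open>(x, x\<^sup>#) + \<i> (y, y\<^sup>#)\<close>, so both parts of an eigenvector of the
  lifting follow trajectories of the system.\<close>

lemma stable_imp_spectral_radius_less_1:
  assumes n: "n > 0" and A: "A \<in> carrier_bimat n n" and st: "bim_asymptotically_stable n A"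
  shows "bim_spectral_radius A < 1"
  unfolding bim_spectral_radius_def
proof (rule spectral_radius_lessI[OF bim_lift_carrier[OF A]])
  note la = bim_lift_carrier[OF A]
  fix e assume "eigenvalue (bim_lift A) e"
  then obtain w where ew: "eigenvector (bim_lift A) w e" by (auto simp: eigenvalue_def)
  then have w: "w \<in> carrier_vec (n + n)" and w0: "w \<noteq> 0\<^sub>v (n + n)"
    using la by (auto simp: eigenvector_def)
  from w w0 obtain j where j: "j < n + n" "w $ j \<noteq> 0" by (metis carrier_vecD eq_vecI index_zero_vec)
  \<comment> \<open>The wanted splitting asks for \<open>w $ i = x $ i + \<i> * y $ i\<close> and,
    after conjugating the lower half, \<open>cnj (w $ (n + i)) = x $ i - \<i> * y $ i\<close>; half
    the sum and half the difference solve this.\<close>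
  define x where "x = vec n (\<lambda>i. (w $ i + cnj (w $ (n + i))) / 2)"
  define y where "y = vec n (\<lambda>i. (w $ i - cnj (w $ (n + i))) / (2 * \<i>))"
  let ?x = "x @\<^sub>v conjugate x" and ?y = "y @\<^sub>v conjugate y"
  have x: "x \<in> carrier_vec n" and y: "y \<in> carrier_vec n" by (simp_all add: x_def y_def)
  have dec: "w = ?x + \<i> \<cdot>\<^sub>v ?y"
  proof (rule eq_vecI)
    fix i assume "i < dim_vec (?x + \<i> \<cdot>\<^sub>v ?y)"
    then have "i < n + n" by (simp add: y_def)
    then show "w $ i = (?x + \<i> \<cdot>\<^sub>v ?y) $ i"
      by (cases "i < n") (auto simp: x_def y_def field_simps)
  qed (use w in \<open>simp add: y_def\<close>)
  have "e ^ k * w $ j = (bim_lift A ^\<^sub>m k *\<^sub>v ?x) $ j + \<i> * (bim_lift A ^\<^sub>m k *\<^sub>v ?y) $ j" for k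
  proof -
    have "e ^ k \<cdot>\<^sub>v w = bim_lift A ^\<^sub>m k *\<^sub>v (?x + \<i> \<cdot>\<^sub>v ?y)"
      using eigenvector_pow[OF la ew, of k] dec by simp
    also have "\<dots> = bim_lift A ^\<^sub>m k *\<^sub>v ?x + \<i> \<cdot>\<^sub>v (bim_lift A ^\<^sub>m k *\<^sub>v ?y)"
      using x y la by (simp add: mult_add_distrib_mat_vec[of _ "n + n" "n + n"]
          mult_mat_vec[of _ "n + n" "n + n"])
    finally have "(e ^ k \<cdot>\<^sub>v w) $ j = \<dots> $ j" by simp
    then show ?thesis using j w la by simp
  qed
  moreover have "(\<lambda>k. (bim_lift A ^\<^sub>m k *\<^sub>v ?x) $ j + \<i> * (bim_lift A ^\<^sub>m k *\<^sub>v ?y) $ j) \<longlonglongrightarrow> 0 + \<i> * 0"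
    by (intro tendsto_intros stable_pow_tendsto_zero[OF A st] x y j)
  ultimately have lim: "(\<lambda>k. e ^ k * w $ j) \<longlonglongrightarrow> 0" by simp
  show "cmod e < 1"
  proof (rule ccontr)
    assume "\<not> cmod e < 1"
    \<comment> \<open>An eigenvalue of modulus at least 1 would keep this null sequence away from 0,
      since coordinate \<open>j\<close> was chosen with \<open>w $ j\<close> nonzero.\<close>
    then have "cmod (w $ j) \<le> cmod (e ^ k * w $ j)" for k
      by (simp add: norm_mult norm_power mult_le_cancel_right1 one_le_power)
    then have "cmod (w $ j) \<le> 0"
      using tendsto_norm[OF lim] by (intro LIMSEQ_le_const) auto
    with j show False by simp
  qed
qed (use n in simp)

lemma bim_spectral_radius_adjoint_less_1:
  assumes n: "n > 0" and A: "A \<in> carrier_bimat n n" and r: "bim_spectral_radius A < 1"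
  shows "bim_spectral_radius (bim_adjoint A) < 1"
  unfolding bim_spectral_radius_def bim_lift_adjoint[OF A]
proof (rule spectral_radius_lessI)
  note la = bim_lift_carrier[OF A]
  show "mat_adjoint (bim_lift A) \<in> carrier_mat (n + n) (n + n)"
    using la by (simp add: mat_adjoint_eq_transpose_conj)
  fix e assume "eigenvalue (mat_adjoint (bim_lift A)) e"
  then have "eigenvalue (bim_lift A) (cnj e)" by (rule eigenvalue_mat_adjoint[OF la])
  then have "cmod (cnj e) \<le> spectral_radius (bim_lift A)"
    by (intro spectral_radius_mem_max(2)[OF la] imageI) (use n in \<open>auto simp: spectrum_def\<close>)
  with r show "cmod e < 1" by (simp add: bim_spectral_radius_def)
qed (use n in simp)

theorem corollary7:
  fixes n p :: nat and A F C :: bimat and D :: "nat \<Rightarrow> bimat"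
  assumes "n > 0" and "p > 0"
    and "A \<in> carrier_bimat n n" and "F \<in> carrier_bimat p p" and "C \<in> carrier_bimat n p"
    and "\<And>k. k \<ge> 1 \<Longrightarrow> D k = bim_sum n p (\<lambda>i. A ^\<^sub>b i *\<^sub>b C *\<^sub>b F ^\<^sub>b i) k"
  shows
    "(bim_spectral_radius A * bim_spectral_radius F < 1 \<longrightarrow>
        (\<exists>!X. X \<in> carrier_bimat n p \<and> X = A *\<^sub>b X *\<^sub>b F +\<^sub>b C) \<and>
        (\<forall>X. X \<in> carrier_bimat n p \<and> X = A *\<^sub>b X *\<^sub>b F +\<^sub>b C \<longrightarrow>
           bim_tendsto D X \<and>
           bim_sums n p (\<lambda>k. A ^\<^sub>b k *\<^sub>b C *\<^sub>b F ^\<^sub>b k) X)) \<and>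
     (bim_asymptotically_stable n A \<longrightarrow>
        (\<forall>Q. Q \<in> carrier_bimat n n \<and> bim_pos_def Q \<longrightarrow>
           (\<exists>!P. P \<in> carrier_bimat n n \<and> P = bim_adjoint A *\<^sub>b P *\<^sub>b A +\<^sub>b Q) \<and>
           (\<forall>P. P \<in> carrier_bimat n n \<and> P = bim_adjoint A *\<^sub>b P *\<^sub>b A +\<^sub>b Q \<longrightarrow>
              bim_sums n n (\<lambda>k. bim_adjoint A ^\<^sub>b k *\<^sub>b Q *\<^sub>b A ^\<^sub>b k) P)))"
proof (intro conjI impI allI)
  assume rho: "bim_spectral_radius A * bim_spectral_radius F < 1"
  show "\<exists>!X. X \<in> carrier_bimat n p \<and> X = A *\<^sub>b X *\<^sub>b F +\<^sub>b C"
    by (rule stein_ex1_solution[OF assms(1-5) rho])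
  fix X assume X: "X \<in> carrier_bimat n p \<and> X = A *\<^sub>b X *\<^sub>b F +\<^sub>b C"
  then show sums: "bim_sums n p (\<lambda>k. A ^\<^sub>b k *\<^sub>b C *\<^sub>b F ^\<^sub>b k) X"
    by (blast intro: stein_solution_sums[OF assms(1-5) rho])
  \<comment> \<open>\<open>D 0\<close> is unconstrained, so \<open>D\<close> and the partial sums
    agree only from index 1 on.\<close>
  have "\<forall>\<^sub>F k in sequentially. bim_sum n p (\<lambda>i. A ^\<^sub>b i *\<^sub>b C *\<^sub>b F ^\<^sub>b i) k = D k"
    using assms(6) by (intro eventually_sequentiallyI[of 1]) simp
  then show "bim_tendsto D X"
    using sums unfolding bim_sums_def by (rule bim_tendsto_cong)
next
  assume st: "bim_asymptotically_stable n A"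
  fix Q assume Q: "Q \<in> carrier_bimat n n \<and> bim_pos_def Q"
  note r = stable_imp_spectral_radius_less_1[OF assms(1,3) st]
  \<comment> \<open>Both radii are below 1 and nonnegative, so their strict bounds multiply.\<close>
  have "bim_spectral_radius (bim_adjoint A) * bim_spectral_radius A < 1 * 1"
    using bim_spectral_radius_adjoint_less_1[OF assms(1,3) r] r assms(1)
      spectral_radius_nonneg[OF bim_lift_carrier[OF assms(3)]]
      spectral_radius_nonneg[OF bim_lift_carrier[OF bim_adjoint_carrier[OF assms(3)]]]
    unfolding bim_spectral_radius_def by (intro mult_strict_mono') auto
  then have rho: "bim_spectral_radius (bim_adjoint A) * bim_spectral_radius A < 1" by simp
  note lyap = assms(1) assms(1) bim_adjoint_carrier[OF assms(3)] assms(3) conjunct1[OF Q] rho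
  show "\<exists>!P. P \<in> carrier_bimat n n \<and> P = bim_adjoint A *\<^sub>b P *\<^sub>b A +\<^sub>b Q"
    by (rule stein_ex1_solution[OF lyap])
  fix P assume "P \<in> carrier_bimat n n \<and> P = bim_adjoint A *\<^sub>b P *\<^sub>b A +\<^sub>b Q"
  then show "bim_sums n n (\<lambda>k. bim_adjoint A ^\<^sub>b k *\<^sub>b Q *\<^sub>b A ^\<^sub>b k) P"
    by (blast intro: stein_solution_sums[OF lyap])
qed

end
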